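(* The two-dimensional semi-discrete nodal DG scheme described in the context, written as $\frac{\mathrm d\mathbf U_h}{\mathrm dt}=\mathcal L_h(\mathbf U_h)$, is well-balanced for a general known equilibrium state solution $\mathbf U^e=(\rho^e,m^e,n^e,\mathcal E^e)^T$; that is, $$\mathcal L_h(\mathbf U_h)=\mathbf 0\qquad\text{if}\quad\mathbf U_h=\mathbf U_h^e,$$ where $\mathbf U_h^e$ is the piecewise tensor-product polynomial interpolating $\mathbf U^e$ at the Gauss–Lobatto points of each cell.
   Context: **Equations.** 2D Euler equations with gravity $\mathbf U_t+\mathbf F(\mathbf U)_x+\mathbf G(\mathbf U)_y=\mathbf S(\mathbf U,x,y)$ on $\Omega=[a,b]\times[c,d]$, $\mathbf U=(\rho,m,n,\mathcal E)^T$, $m=\rho u$, $n=\rho v$, $\mathbf F=(m,\rho u^2+p,\rho uv,u(\mathcal E+p))^T$, $\mathbf G=(n,\rho uv,\rho v^2+p,v(\mathcal E+p))^T$, $\mathbf S=(0,-\rho\phi_x,-\rho\phi_y,-m\phi_x-n\phi_y)^T$, with given time-independent potential $\phi(x,y)$ and $\mathcal E=\frac p{\gamma-1}+\frac12\rho(u^2+v^2)$, $\gamma=1.4$. $\mathscr G=\{\mathbf U:\rho>0,\ p>0\}$. With $s=\ln(p\rho^{-\gamma})$, the entropy variable is $\mathbf V(\mathbf U)=\big(\frac{\gamma-s}{\gamma-1}-\frac{\rho(u^2+v^2)}{2p},\frac{\rho u}p,\frac{\rho v}p,-\frac\rho p\big)^T$ and the potential fluxes are $\psi_F=\rho u$,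 $\psi_G=\rho v$. **Equilibrium.** $\mathbf U^e=(\rho^e,m^e,n^e,\mathcal E^e)^T:\Omega\to\mathscr G$ is a given (classical) steady state, hydrostatic or moving: $\mathbf F(\mathbf U^e)_x+\mathbf G(\mathbf U^e)_y=\mathbf S(\mathbf U^e,x,y)$. **Discretization.** $\Omega$ is split into $N_x\times N_y$ uniform rectangles $K_{ij}=[x_{i-1/2},x_{i+1/2}]\times[y_{j-1/2},y_{j+1/2}]$ with center $(x_i,y_j)$ and sizes $\Delta x,\Delta y$. $-1=X_0<\dots<X_k=1$ ($k\ge1$) are the Gauss–Lobatto points with weights $\omega_0,\dots,\omega_k$, $Y_{j_1}=X_{j_1}$; $L_l$ the Lagrange basis polynomials at these points; $D_{jl}=L_l'(X_j)$; $\tau_0=-1$, $\tau_k=1$, $\tau_j=0$ otherwise. $x_i(X)=x_i+\frac{\Delta x}2X$, $y_j(Y)=y_j+\frac{\Delta y}2Y$. The unknown $\mathbf U_h$ is a piecewise tensor-product polynomial of degree $\le k$ in each variable with nodal values $\mathbf U_{i_1,j_1}^{i,j}=\mathbf U_h|_{K_{ij}}(x_i(X_{i_1}),y_j(Y_{j_1}))$. A superscript $e$ denotes evaluation with $\mathbf U^e$ at the node; $\mathbf F_{i_1,j_1}^{i,j}=\mathbf F(\mathbf U_{i_1,j_1}^{i,j})$, $\mathbf G_{i_1,j_1}^{i,j}=\mathbf G(\mathbf U_{i_1,j_1}^{i,j})$, $\mathbf V_{i_1,j_1}^{i,j}=\mathbf V(\mathbf U_{i_1,j_1}^{i,j})$.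 $\mathbf F^S,\mathbf G^S$ are entropy conservative fluxes: symmetric, consistent with $\mathbf F,\mathbf G$, and $(\mathbf V_R-\mathbf V_L)^T\mathbf F^S(\mathbf U_L,\mathbf U_R)=\psi_{F,R}-\psi_{F,L}$, $(\mathbf V_R-\mathbf V_L)^T\mathbf G^S(\mathbf U_L,\mathbf U_R)=\psi_{G,R}-\psi_{G,L}$. $\hat{\mathbf F}(\mathbf U_L,\mathbf U_R)=\frac12(\mathbf F(\mathbf U_L)+\mathbf F(\mathbf U_R))-\frac\alpha2(\mathbf U_R-\mathbf U_L)$ is the Lax–Friedrichs flux with $\alpha=\alpha(\mathbf U_L,\mathbf U_R)>0$ an estimate of the maximal local wave speed in the $x$-direction; $\hat{\mathbf G}$ is defined analogously in the $y$-direction. $\mathbf F_{0,j_1}^{*,i,j}=\hat{\mathbf F}(\mathbf U_{k,j_1}^{i-1,j},\mathbf U_{0,j_1}^{i,j})$, $\mathbf F_{k,j_1}^{*,i,j}=\hat{\mathbf F}(\mathbf U_{k,j_1}^{i,j},\mathbf U_{0,j_1}^{i+1,j})$, $\mathbf F_{i_1,j_1}^{*,i,j}=\mathbf 0$ for $0<i_1<k$; $\mathbf G_{i_1,0}^{*,i,j}=\hat{\mathbf G}(\mathbf U_{i_1,k}^{i,j-1},\mathbf U_{i_1,0}^{i,j})$, $\mathbf G_{i_1,k}^{*,i,j}=\hat{\mathbf G}(\mathbf U_{i_1,k}^{i,j},\mathbf U_{i_1,0}^{i,j+1})$, $\mathbf G_{i_1,j_1}^{*,i,j}=\mathbf 0$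 for $0<j_1<k$. **Scheme.** For all $i,j,i_1,j_1$ (the right-hand side defines $\mathcal L_h$), $$\begin{aligned}\frac{\mathrm d\mathbf U_{i_1,j_1}^{i,j}}{\mathrm dt}=&-\frac2{\Delta x}\sum_{l=0}^k2D_{i_1,l}\mathbf F^S(\mathbf U_{i_1,j_1}^{i,j},\mathbf U_{l,j_1}^{i,j})+\frac2{\Delta x}\frac{\tau_{i_1}}{\omega_{i_1}}(\mathbf F_{i_1,j_1}^{i,j}-\mathbf F_{i_1,j_1}^{*,i,j})\\&-\frac2{\Delta y}\sum_{l=0}^k2D_{j_1,l}\mathbf G^S(\mathbf U_{i_1,j_1}^{i,j},\mathbf U_{i_1,l}^{i,j})+\frac2{\Delta y}\frac{\tau_{j_1}}{\omega_{j_1}}(\mathbf G_{i_1,j_1}^{i,j}-\mathbf G_{i_1,j_1}^{*,i,j})\\&+\mathbf S_{i_1,j_1}^{i,j}+\mathbf S_{i_1,j_1}^{0,i,j}-\mathbf S_{i_1,j_1}^{corr,i,j},\end{aligned}$$ where $\mathbf S_{i_1,j_1}^{i,j}$ and $\mathbf S_{i_1,j_1}^{e,i,j}$ are $\mathbf S$ evaluated at the node with $\mathbf U_{i_1,j_1}^{i,j}$ and $\mathbf U_{i_1,j_1}^{e,i,j}$ respectively (using the exact $\phi_x,\phi_y$ at the node), $$\mathbf S_{i_1,j_1}^{0,i,j}=\frac2{\Delta x}\sum_{l=0}^k2D_{i_1,l}\mathbf F^S(\mathbf U_{i_1,j_1}^{e,i,j},\mathbf U_{l,j_1}^{e,i,j})+\frac2{\Delta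 y}\sum_{l=0}^k2D_{j_1,l}\mathbf G^S(\mathbf U_{i_1,j_1}^{e,i,j},\mathbf U_{i_1,l}^{e,i,j})-\mathbf S_{i_1,j_1}^{e,i,j},$$ $$\mathbf S_{i_1,j_1}^{corr,i,j}=\sigma_{ij}(\mathbf V_{i_1,j_1}^{i,j}-\bar{\mathbf V}^{i,j}),\quad\bar{\mathbf V}^{i,j}=\sum_{i_1,j_1=0}^k\frac{\omega_{i_1}\omega_{j_1}}4\mathbf V_{i_1,j_1}^{i,j},\quad\sigma_{ij}=\frac{\sum_{i_1,j_1=0}^k\omega_{i_1}\omega_{j_1}(\mathbf V_{i_1,j_1}^{i,j}-\mathbf V_{i_1,j_1}^{e,i,j})^T\mathbf S_{i_1,j_1}^{0,i,j}}{\sum_{i_1,j_1=0}^k\omega_{i_1}\omega_{j_1}\|\mathbf V_{i_1,j_1}^{i,j}-\bar{\mathbf V}^{i,j}\|^2};$$ if the denominator of $\sigma_{ij}$ is zero, $\mathbf S_{i_1,j_1}^{corr,i,j}=\mathbf 0$. **Boundary treatment.** The exterior traces used on $\partial\Omega$ are consistent with the equilibrium: when $\mathbf U_h=\mathbf U_h^e$, they equal the interior traces. *)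

theory Defs
  imports "HOL-Analysis.Analysis" "HOL-Computational_Algebra.Polynomial"
begin

section \<open>The Euler equations with gravity\<close>

text \<open>A state is \<open>(\<rho>, m, n, E)\<close>, with components \<open>U $ 1, \<dots>, U $ 4\<close>.\<close>

type_synonym state = "real ^ 4"

definition \<gamma> :: real where "\<gamma> = 7 / 5"

definition dens :: "state \<Rightarrow> real" where "dens U = U $ 1"
definition momx :: "state \<Rightarrow> real" where "momx U = U $ 2"
definition momy :: "state \<Rightarrow> real" where "momy U = U $ 3"
definition energy :: "state \<Rightarrow> real" where "energy U = U $ 4"
definition velx :: "state \<Rightarrow> real" where "velx U = momx U / dens U"
definition vely :: "state \<Rightarrow> real" where "vely U = momy U / dens U"

text \<open>Obtained by solving \<open>E = p / (\<gamma> - 1) + \<rho> (u\<^sup>2 + v\<^sup>2) / 2\<close> for \<open>p\<close>.\<close>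

definition pressure :: "state \<Rightarrow> real" where
  "pressure U = (\<gamma> - 1) * (energy U - dens U * ((velx U)\<^sup>2 + (vely U)\<^sup>2) / 2)"

definition admissible :: "state set" where
  "admissible = {U. dens U > 0 \<and> pressure U > 0}"

definition flux_F :: "state \<Rightarrow> state" where
  "flux_F U = vector [momx U,
     dens U * (velx U)\<^sup>2 + pressure U,
     dens U * velx U * vely U,
     velx U * (energy U + pressure U)]"

definition flux_G :: "state \<Rightarrow> state" where
  "flux_G U = vector [momy U,
     dens U * velx U * vely U,
     dens U * (vely U)\<^sup>2 + pressure U,
     vely U * (energy U + pressure U)]"

definition spec_entropy :: "state \<Rightarrow> real" where
  "spec_entropy U = ln (pressure U * dens U powr (- \<gamma>))"

definition entropy_var :: "state \<Rightarrow> state" where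
  "entropy_var U = vector [
     (\<gamma> - spec_entropy U) / (\<gamma> - 1)
       - dens U * ((velx U)\<^sup>2 + (vely U)\<^sup>2) / (2 * pressure U),
     dens U * velx U / pressure U,
     dens U * vely U / pressure U,
     - dens U / pressure U]"

definition psi_F :: "state \<Rightarrow> real" where "psi_F U = dens U * velx U"
definition psi_G :: "state \<Rightarrow> real" where "psi_G U = dens U * vely U"

definition entropy_conservative ::
  "(state \<Rightarrow> state) \<Rightarrow> (state \<Rightarrow> real) \<Rightarrow> (state \<Rightarrow> state \<Rightarrow> state) \<Rightarrow> bool" where
  "entropy_conservative f \<psi> fS \<longleftrightarrow>
     (\<forall>U\<in>admissible. fS U U = f U) \<and>
     (\<forall>UL\<in>admissible. \<forall>UR\<in>admissible.
        fS UL UR = fS UR UL \<and>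
        (entropy_var UR - entropy_var UL) \<bullet> fS UL UR = \<psi> UR - \<psi> UL)"

definition lax_friedrichs ::
  "(state \<Rightarrow> state) \<Rightarrow> (state \<Rightarrow> state \<Rightarrow> real) \<Rightarrow> state \<Rightarrow> state \<Rightarrow> state" where
  "lax_friedrichs f \<alpha> UL UR =
     (1 / 2) *\<^sub>R (f UL + f UR) - (\<alpha> UL UR / 2) *\<^sub>R (UR - UL)"


section \<open>Gauss--Lobatto nodes and the Lagrange basis\<close>

text \<open>The rule with nodes \<open>-1 = X 0 < \<dots> < X k = 1\<close> that is exact up to degree \<open>2 k - 1\<close>;
  this determines both \<open>X\<close> and \<open>\<omega>\<close> on \<open>{..k}\<close>.\<close>

definition gauss_lobatto :: "nat \<Rightarrow> (nat \<Rightarrow> real) \<Rightarrow> (nat \<Rightarrow> real) \<Rightarrow> bool" where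
  "gauss_lobatto k X \<omega> \<longleftrightarrow>
     strict_mono_on {..k} X \<and> X 0 = -1 \<and> X k = 1 \<and>
     (\<forall>q :: real poly. degree q < 2 * k \<longrightarrow>
        (\<Sum>j\<le>k. \<omega> j * poly q (X j)) = integral {-1..1} (poly q))"

definition lagrange_basis :: "nat \<Rightarrow> (nat \<Rightarrow> real) \<Rightarrow> nat \<Rightarrow> real poly" where
  "lagrange_basis k X l = (\<Prod>j\<in>{..k} - {l}. smult (1 / (X l - X j)) [:- X j, 1:])"

definition diff_matrix :: "nat \<Rightarrow> (nat \<Rightarrow> real) \<Rightarrow> nat \<Rightarrow> nat \<Rightarrow> real" where
  "diff_matrix k X j l = poly (pderiv (lagrange_basis k X l)) (X j)"

definition \<tau> :: "nat \<Rightarrow> nat \<Rightarrow> real" where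
  "\<tau> k j = (if j = 0 then -1 else if j = k then 1 else 0)"


section \<open>Data of the scheme\<close>

text \<open>A field \<open>W\<close> gives for every cell \<open>(i, j)\<close>, \<open>1 \<le> i \<le> Nx\<close>, \<open>1 \<le> j \<le> Ny\<close>, a function
  \<open>W i j\<close> of the physical coordinates, so that it is double-valued on cell interfaces.\<close>

type_synonym field = "nat \<Rightarrow> nat \<Rightarrow> real \<Rightarrow> real \<Rightarrow> state"

datatype side = West | East | South | North

text \<open>\<open>ext W s c q\<close> is the exterior trace used on side \<open>s\<close> of the domain when the numerical
  solution is \<open>W\<close>: \<open>c\<close> is the index of the boundary cell along that side and \<open>q\<close> the index of the
  node on its boundary edge.\<close>

record dg_data =
  xmin :: real
  xmax :: real
  ymin :: real
  ymax :: real
  Nx :: nat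
  Ny :: nat
  deg :: nat
  pt :: "nat \<Rightarrow> real"
  wt :: "nat \<Rightarrow> real"
  pot :: "real \<Rightarrow> real \<Rightarrow> real"
  Ue :: "real \<Rightarrow> real \<Rightarrow> state"
  FS :: "state \<Rightarrow> state \<Rightarrow> state"
  GS :: "state \<Rightarrow> state \<Rightarrow> state"
  alphax :: "state \<Rightarrow> state \<Rightarrow> real"
  alphay :: "state \<Rightarrow> state \<Rightarrow> real"
  ext :: "field \<Rightarrow> side \<Rightarrow> nat \<Rightarrow> nat \<Rightarrow> state"

text \<open>Partial derivatives on the closed rectangle, one-sided on its boundary.\<close>

definition ddx :: "dg_data \<Rightarrow> (real \<Rightarrow> real \<Rightarrow> 'a::real_normed_vector) \<Rightarrow> real \<Rightarrow> real \<Rightarrow> 'a" where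
  "ddx S f x y = vector_derivative (\<lambda>s. f s y) (at x within {xmin S..xmax S})"

definition ddy :: "dg_data \<Rightarrow> (real \<Rightarrow> real \<Rightarrow> 'a::real_normed_vector) \<Rightarrow> real \<Rightarrow> real \<Rightarrow> 'a" where
  "ddy S f x y = vector_derivative (\<lambda>s. f x s) (at y within {ymin S..ymax S})"

definition has_partials :: "dg_data \<Rightarrow> (real \<Rightarrow> real \<Rightarrow> 'a::real_normed_vector) \<Rightarrow> bool" where
  "has_partials S f \<longleftrightarrow> (\<forall>x\<in>{xmin S..xmax S}. \<forall>y\<in>{ymin S..ymax S}.
     (\<lambda>s. f s y) differentiable (at x within {xmin S..xmax S}) \<and>
     (\<lambda>s. f x s) differentiable (at y within {ymin S..ymax S}))"

definition source :: "dg_data \<Rightarrow> state \<Rightarrow> real \<Rightarrow> real \<Rightarrow> state" where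
  "source S U x y = vector [0,
     - dens U * ddx S (pot S) x y,
     - dens U * ddy S (pot S) x y,
     - momx U * ddx S (pot S) x y - momy U * ddy S (pot S) x y]"

definition steady_state :: "dg_data \<Rightarrow> bool" where
  "steady_state S \<longleftrightarrow>
     (\<forall>x\<in>{xmin S..xmax S}. \<forall>y\<in>{ymin S..ymax S}. Ue S x y \<in> admissible) \<and>
     has_partials S (Ue S) \<and>
     (\<forall>x\<in>{xmin S..xmax S}. \<forall>y\<in>{ymin S..ymax S}.
        ddx S (\<lambda>x y. flux_F (Ue S x y)) x y + ddy S (\<lambda>x y. flux_G (Ue S x y)) x y
          = source S (Ue S x y) x y)"


section \<open>Mesh, interpolation, nodal values\<close>

definition dx :: "dg_data \<Rightarrow> real" where "dx S = (xmax S - xmin S) / real (Nx S)"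
definition dy :: "dg_data \<Rightarrow> real" where "dy S = (ymax S - ymin S) / real (Ny S)"

definition xc :: "dg_data \<Rightarrow> nat \<Rightarrow> real" where "xc S i = xmin S + (real i - 1 / 2) * dx S"
definition yc :: "dg_data \<Rightarrow> nat \<Rightarrow> real" where "yc S j = ymin S + (real j - 1 / 2) * dy S"

definition cell :: "dg_data \<Rightarrow> nat \<Rightarrow> nat \<Rightarrow> (real \<times> real) set" where
  "cell S i j = {xc S i - dx S / 2..xc S i + dx S / 2} \<times> {yc S j - dy S / 2..yc S j + dy S / 2}"

definition xnode :: "dg_data \<Rightarrow> nat \<Rightarrow> nat \<Rightarrow> real" where
  "xnode S i i1 = xc S i + dx S / 2 * pt S i1"
definition ynode :: "dg_data \<Rightarrow> nat \<Rightarrow> nat \<Rightarrow> real" where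
  "ynode S j j1 = yc S j + dy S / 2 * pt S j1"

text \<open>The piecewise tensor-product polynomial of degree at most \<open>deg S\<close> in each variable with
  prescribed nodal values \<open>c i j i1 j1\<close>.\<close>

definition from_nodal :: "dg_data \<Rightarrow> (nat \<Rightarrow> nat \<Rightarrow> nat \<Rightarrow> nat \<Rightarrow> state) \<Rightarrow> field" where
  "from_nodal S c i j x y =
     (\<Sum>i1\<le>deg S. \<Sum>j1\<le>deg S.
        (poly (lagrange_basis (deg S) (pt S) i1) ((x - xc S i) / (dx S / 2)) *
         poly (lagrange_basis (deg S) (pt S) j1) ((y - yc S j) / (dy S / 2))) *\<^sub>R c i j i1 j1)"

definition nodal :: "dg_data \<Rightarrow> field \<Rightarrow> nat \<Rightarrow> nat \<Rightarrow> nat \<Rightarrow> nat \<Rightarrow> state" where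
  "nodal S W i j i1 j1 = W i j (xnode S i i1) (ynode S j j1)"

definition nodal_eq :: "dg_data \<Rightarrow> nat \<Rightarrow> nat \<Rightarrow> nat \<Rightarrow> nat \<Rightarrow> state" where
  "nodal_eq S i j i1 j1 = Ue S (xnode S i i1) (ynode S j j1)"

definition Uh_eq :: "dg_data \<Rightarrow> field" where
  "Uh_eq S = from_nodal S (nodal_eq S)"


section \<open>The semi-discrete operator\<close>

definition num_F :: "dg_data \<Rightarrow> field \<Rightarrow> nat \<Rightarrow> nat \<Rightarrow> nat \<Rightarrow> nat \<Rightarrow> state" where
  "num_F S W i j i1 j1 =
     (if i1 = 0 then
        lax_friedrichs flux_F (alphax S)
          (if i = 1 then ext S W West j j1 else nodal S W (i - 1) j (deg S) j1)
          (nodal S W i j 0 j1)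
      else if i1 = deg S then
        lax_friedrichs flux_F (alphax S)
          (nodal S W i j (deg S) j1)
          (if i = Nx S then ext S W East j j1 else nodal S W (i + 1) j 0 j1)
      else 0)"

definition num_G :: "dg_data \<Rightarrow> field \<Rightarrow> nat \<Rightarrow> nat \<Rightarrow> nat \<Rightarrow> nat \<Rightarrow> state" where
  "num_G S W i j i1 j1 =
     (if j1 = 0 then
        lax_friedrichs flux_G (alphay S)
          (if j = 1 then ext S W South i i1 else nodal S W i (j - 1) i1 (deg S))
          (nodal S W i j i1 0)
      else if j1 = deg S then
        lax_friedrichs flux_G (alphay S)
          (nodal S W i j i1 (deg S))
          (if j = Ny S then ext S W North i i1 else nodal S W i (j + 1) i1 0)
      else 0)"

definition vol_F :: "dg_data \<Rightarrow> (nat \<Rightarrow> nat \<Rightarrow> nat \<Rightarrow> nat \<Rightarrow> state) \<Rightarrow>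
    nat \<Rightarrow> nat \<Rightarrow> nat \<Rightarrow> nat \<Rightarrow> state" where
  "vol_F S c i j i1 j1 = (2 / dx S) *\<^sub>R
     (\<Sum>l\<le>deg S. (2 * diff_matrix (deg S) (pt S) i1 l) *\<^sub>R FS S (c i j i1 j1) (c i j l j1))"

definition vol_G :: "dg_data \<Rightarrow> (nat \<Rightarrow> nat \<Rightarrow> nat \<Rightarrow> nat \<Rightarrow> state) \<Rightarrow>
    nat \<Rightarrow> nat \<Rightarrow> nat \<Rightarrow> nat \<Rightarrow> state" where
  "vol_G S c i j i1 j1 = (2 / dy S) *\<^sub>R
     (\<Sum>l\<le>deg S. (2 * diff_matrix (deg S) (pt S) j1 l) *\<^sub>R GS S (c i j i1 j1) (c i j i1 l))"

definition source_0 :: "dg_data \<Rightarrow> nat \<Rightarrow> nat \<Rightarrow> nat \<Rightarrow> nat \<Rightarrow> state" where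
  "source_0 S i j i1 j1 =
     vol_F S (nodal_eq S) i j i1 j1 + vol_G S (nodal_eq S) i j i1 j1
       - source S (nodal_eq S i j i1 j1) (xnode S i i1) (ynode S j j1)"

definition Vbar :: "dg_data \<Rightarrow> field \<Rightarrow> nat \<Rightarrow> nat \<Rightarrow> state" where
  "Vbar S W i j = (\<Sum>i1\<le>deg S. \<Sum>j1\<le>deg S.
     (wt S i1 * wt S j1 / 4) *\<^sub>R entropy_var (nodal S W i j i1 j1))"

definition sigma_num :: "dg_data \<Rightarrow> field \<Rightarrow> nat \<Rightarrow> nat \<Rightarrow> real" where
  "sigma_num S W i j = (\<Sum>i1\<le>deg S. \<Sum>j1\<le>deg S. wt S i1 * wt S j1 *
     ((entropy_var (nodal S W i j i1 j1) - entropy_var (nodal_eq S i j i1 j1))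
        \<bullet> source_0 S i j i1 j1))"

definition sigma_den :: "dg_data \<Rightarrow> field \<Rightarrow> nat \<Rightarrow> nat \<Rightarrow> real" where
  "sigma_den S W i j = (\<Sum>i1\<le>deg S. \<Sum>j1\<le>deg S. wt S i1 * wt S j1 *
     (norm (entropy_var (nodal S W i j i1 j1) - Vbar S W i j))\<^sup>2)"

definition source_corr :: "dg_data \<Rightarrow> field \<Rightarrow> nat \<Rightarrow> nat \<Rightarrow> nat \<Rightarrow> nat \<Rightarrow> state" where
  "source_corr S W i j i1 j1 =
     (if sigma_den S W i j = 0 then 0
      else (sigma_num S W i j / sigma_den S W i j) *\<^sub>R
             (entropy_var (nodal S W i j i1 j1) - Vbar S W i j))"

definition rhs :: "dg_data \<Rightarrow> field \<Rightarrow> nat \<Rightarrow> nat \<Rightarrow> nat \<Rightarrow> nat \<Rightarrow> state" where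
  "rhs S W i j i1 j1 =
     - vol_F S (nodal S W) i j i1 j1
     + (2 / dx S * (\<tau> (deg S) i1 / wt S i1)) *\<^sub>R
         (flux_F (nodal S W i j i1 j1) - num_F S W i j i1 j1)
     - vol_G S (nodal S W) i j i1 j1
     + (2 / dy S * (\<tau> (deg S) j1 / wt S j1)) *\<^sub>R
         (flux_G (nodal S W i j i1 j1) - num_G S W i j i1 j1)
     + source S (nodal S W i j i1 j1) (xnode S i i1) (ynode S j j1)
     + source_0 S i j i1 j1
     - source_corr S W i j i1 j1"

text \<open>The scheme is \<open>dU\<^sub>h/dt = Lh S U\<^sub>h\<close>: the time derivative of the nodal values is \<open>rhs\<close>.\<close>

definition Lh :: "dg_data \<Rightarrow> field \<Rightarrow> field" where
  "Lh S W = from_nodal S (rhs S W)"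

definition boundary_consistent :: "dg_data \<Rightarrow> bool" where
  "boundary_consistent S \<longleftrightarrow>
     (\<forall>j\<in>{1..Ny S}. \<forall>j1\<le>deg S.
        ext S (Uh_eq S) West j j1 = nodal S (Uh_eq S) 1 j 0 j1 \<and>
        ext S (Uh_eq S) East j j1 = nodal S (Uh_eq S) (Nx S) j (deg S) j1) \<and>
     (\<forall>i\<in>{1..Nx S}. \<forall>i1\<le>deg S.
        ext S (Uh_eq S) South i i1 = nodal S (Uh_eq S) i 1 i1 0 \<and>
        ext S (Uh_eq S) North i i1 = nodal S (Uh_eq S) i (Ny S) i1 (deg S))"

end

theory Submission
  imports Defs
begin

text \<open>At the Gauss--Lobatto nodes the interpolant \<open>U\<^sub>h\<^sup>e\<close> takes the values of \<open>U\<^sup>e\<close>. Since the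
  endpoints are nodes and \<open>U\<^sup>e\<close> is single-valued, both traces at every cell interface agree, so the
  Lax--Friedrichs flux reduces to the physical flux and the interface terms vanish. The volume
  terms and the source are cancelled exactly by \<open>S\<^sup>0\<close>, and \<open>\<sigma>\<close> vanishes because its numerator
  contains the factor \<open>V - V\<^sup>e = 0\<close>.\<close>

lemma poly_lagrange_basis_node:
  assumes "inj_on X {..k}" "l \<le> k" "i \<le> k"
  shows "poly (lagrange_basis k X l) (X i) = (if i = l then 1 else 0)"
proof -
  have "X l \<noteq> X j" if "j \<in> {..k} - {l}" for j
    using that assms(1,2) by (auto dest: inj_onD)
  then show ?thesis
    \<comment> \<open>For \<open>i = l\<close> every factor is 1; for \<open>i\<close> distinct from
      \<open>l\<close> the factor with index \<open>i\<close> vanishes.\<close>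
    using assms(3) by (auto simp: lagrange_basis_def poly_prod diff_divide_distrib [symmetric]
        intro!: prod.neutral prod_zero bexI [of _ i])
qed

lemma nodal_from_nodal:
  assumes "inj_on (pt S) {..deg S}" "dx S \<noteq> 0" "dy S \<noteq> 0" "i1 \<le> deg S" "j1 \<le> deg S"
  shows "nodal S (from_nodal S c) i j i1 j1 = c i j i1 j1"
proof -
  have "nodal S (from_nodal S c) i j i1 j1 =
      (\<Sum>a\<le>deg S. \<Sum>b\<le>deg S. if b = j1 then if a = i1 then c i j a b else 0 else 0)"
    using assms unfolding nodal_def from_nodal_def xnode_def ynode_def
    by (intro sum.cong refl) (auto simp: poly_lagrange_basis_node)
  also have "\<dots> = c i j i1 j1"
    using assms by (simp add: sum.delta)
  finally show ?thesis .
qed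

lemma lax_friedrichs_same: "lax_friedrichs f \<alpha> U U = f U"
  by (simp add: lax_friedrichs_def scaleR_half_double)

text \<open>Both sides are \<open>xmin S + real i * dx S\<close>.\<close>

lemma xnode_interface:
  assumes "pt S 0 = -1" "pt S (deg S) = 1"
  shows "xnode S (Suc i) 0 = xnode S i (deg S)"
  using assms by (simp add: xnode_def xc_def algebra_simps)

lemma ynode_interface:
  assumes "pt S 0 = -1" "pt S (deg S) = 1"
  shows "ynode S (Suc j) 0 = ynode S j (deg S)"
  using assms by (simp add: ynode_def yc_def algebra_simps)

text \<open>Nonzero mesh sizes make the map to reference coordinates invertible, distinct nodes give
  Lagrange interpolation, and endpoint nodes let neighbouring cells share interface points.\<close>

locale lobatto_mesh =
  fixes S :: dg_data
  assumes dx_nz: "dx S \<noteq> 0" and dy_nz: "dy S \<noteq> 0"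
    and inj_pt: "inj_on (pt S) {..deg S}"
    and pt_0: "pt S 0 = -1" and pt_deg: "pt S (deg S) = 1"
    and boundary: "boundary_consistent S"
begin

lemma nodal_Uh_eq:
  assumes "i1 \<le> deg S" "j1 \<le> deg S"
  shows "nodal S (Uh_eq S) i j i1 j1 = nodal_eq S i j i1 j1"
  using nodal_from_nodal [OF inj_pt dx_nz dy_nz assms] by (simp add: Uh_eq_def)

lemma nodal_eq_interface_x: "nodal_eq S (Suc i) j 0 j1 = nodal_eq S i j (deg S) j1"
  by (simp add: nodal_eq_def xnode_interface pt_0 pt_deg)

lemma nodal_eq_interface_y: "nodal_eq S i (Suc j) i1 0 = nodal_eq S i j i1 (deg S)"
  by (simp add: nodal_eq_def ynode_interface pt_0 pt_deg)

lemma num_F_Uh_eq: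
  assumes "i \<in> {1..Nx S}" "j \<in> {1..Ny S}" "j1 \<le> deg S" "i1 = 0 \<or> i1 = deg S"
  shows "num_F S (Uh_eq S) i j i1 j1 = flux_F (nodal_eq S i j i1 j1)"
proof -
  have "ext S (Uh_eq S) West j j1 = nodal_eq S 1 j 0 j1"
    and "ext S (Uh_eq S) East j j1 = nodal_eq S (Nx S) j (deg S) j1"
    using boundary assms by (auto simp: boundary_consistent_def nodal_Uh_eq)
  then show ?thesis
    \<comment> \<open>The instance at \<open>i - 1\<close> serves the west interface, where
      \<open>Suc (i - 1) = i\<close> because \<open>i\<close> is at least 1.\<close>
    using assms nodal_eq_interface_x [of "i - 1" j j1]
    by (auto simp: num_F_def nodal_Uh_eq nodal_eq_interface_x lax_friedrichs_same)
qed

lemma num_G_Uh_eq: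
  assumes "i \<in> {1..Nx S}" "j \<in> {1..Ny S}" "i1 \<le> deg S" "j1 = 0 \<or> j1 = deg S"
  shows "num_G S (Uh_eq S) i j i1 j1 = flux_G (nodal_eq S i j i1 j1)"
proof -
  have "ext S (Uh_eq S) South i i1 = nodal_eq S i 1 i1 0"
    and "ext S (Uh_eq S) North i i1 = nodal_eq S i (Ny S) i1 (deg S)"
    using boundary assms by (auto simp: boundary_consistent_def nodal_Uh_eq)
  then show ?thesis
    using assms nodal_eq_interface_y [of i "j - 1" i1]
    by (auto simp: num_G_def nodal_Uh_eq nodal_eq_interface_y lax_friedrichs_same)
qed

lemma source_corr_Uh_eq: "source_corr S (Uh_eq S) i j i1 j1 = 0"
proof -
  have "sigma_num S (Uh_eq S) i j = 0"
    unfolding sigma_num_def by (intro sum.neutral ballI) (simp add: nodal_Uh_eq)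
  \<comment> \<open>Both branches give zero: a vanishing denominator by convention, otherwise
    through the factor \<open>sigma_num\<close>.\<close>
  then show ?thesis
    by (simp add: source_corr_def)
qed

lemma rhs_Uh_eq:
  assumes "i \<in> {1..Nx S}" "j \<in> {1..Ny S}" "i1 \<le> deg S" "j1 \<le> deg S"
  shows "rhs S (Uh_eq S) i j i1 j1 = 0"
proof -
  have "vol_F S (nodal S (Uh_eq S)) i j i1 j1 = vol_F S (nodal_eq S) i j i1 j1"
    and "vol_G S (nodal S (Uh_eq S)) i j i1 j1 = vol_G S (nodal_eq S) i j i1 j1"
    using assms by (auto simp: vol_F_def vol_G_def nodal_Uh_eq)
  \<comment> \<open>At interior nodes \<open>num_F\<close> is 0 rather than the physical flux, but
    there the weight \<open>\<tau>\<close> removes the term.\<close>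
  moreover have "\<tau> (deg S) i1 = 0 \<or> num_F S (Uh_eq S) i j i1 j1 = flux_F (nodal_eq S i j i1 j1)"
    using num_F_Uh_eq assms by (auto simp: \<tau>_def)
  moreover have "\<tau> (deg S) j1 = 0 \<or> num_G S (Uh_eq S) i j i1 j1 = flux_G (nodal_eq S i j i1 j1)"
    using num_G_Uh_eq assms by (auto simp: \<tau>_def)
  ultimately show ?thesis
    using assms by (auto simp: rhs_def source_0_def source_corr_Uh_eq nodal_Uh_eq)
qed

text \<open>All coefficients of the Lagrange expansion vanish, so the point need not lie in the
  cell.\<close>

lemma Lh_Uh_eq:
  assumes "i \<in> {1..Nx S}" "j \<in> {1..Ny S}"
  shows "Lh S (Uh_eq S) i j x y = 0"
  using assms by (simp add: Lh_def from_nodal_def rhs_Uh_eq)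

end

theorem theorem4p3:
  fixes S :: dg_data
  assumes "xmin S < xmax S" and "ymin S < ymax S"
    and "Nx S \<ge> 1" and "Ny S \<ge> 1" and "deg S \<ge> 1"
    and "gauss_lobatto (deg S) (pt S) (wt S)"
    and "has_partials S (pot S)"
    and "steady_state S"
    and "entropy_conservative flux_F psi_F (FS S)"
    and "entropy_conservative flux_G psi_G (GS S)"
    and "\<forall>UL\<in>admissible. \<forall>UR\<in>admissible. alphax S UL UR > 0 \<and> alphay S UL UR > 0"
    and "boundary_consistent S"
  shows "\<forall>i\<in>{1..Nx S}. \<forall>j\<in>{1..Ny S}. \<forall>(x, y)\<in>cell S i j. Lh S (Uh_eq S) i j x y = 0"
proof -
  interpret lobatto_mesh S
  proof
    show "dx S \<noteq> 0" "dy S \<noteq> 0"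
      using assms(1-4) by (auto simp: dx_def dy_def)
    show "inj_on (pt S) {..deg S}" "pt S 0 = -1" "pt S (deg S) = 1"
      using assms(6) by (auto simp: gauss_lobatto_def strict_mono_on_imp_inj_on)
  qed fact
  show ?thesis
    using Lh_Uh_eq by auto
qed

end
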